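(* Let $A$ be a finite subset of $\mathbb Z_{>0}$, let $m\ge 1$ be an odd integer and $\mathcal R=\{1,3,\dots,m\}\cap A$. For all $\pi\in\Pi_{\Gamma_A^{\mathcal R}}$, $$(-1)^{|\pi|}\mu_{\Pi_{\Gamma_A^{\mathcal R}}}(\hat 0,\pi)=\bigl|\{\sigma\in\mathcal D_A^{\mathcal R}:\operatorname{cyc}(\sigma)=\pi\}\bigr|.$$ Consequently, $$\chi_{\Pi_{\Gamma_A^{\mathcal R}}}(t)=\sum_{k=1}^{|A|}s_{\mathcal RD}(A,k)\,t^{k-1},$$ where $(-1)^{k}s_{\mathcal RD}(A,k)$ is equal to the number of $\mathcal R$-D-permutations on $A$ with exactly $k$ cycles.
   Context: Graph: $\Gamma_A^{\mathcal R}$ is the graph on vertex set $A$ with edge set $\{\{u,v\}:u,v\in A,\ u<v,\ u\text{ odd},\ v\text{ even}\}\cup\{\{u,v\}:u,v\in A,\ u<v\le m,\ u,v\text{ odd}\}$. Bond lattice: for a finite graph $G=(V,E)$, $\Pi_G$ is the poset of set partitions $\pi$ of $V$ such that the induced subgraph of $G$ on each block of $\pi$ is connected, ordered so that $\pi\le\pi'$ iff every block of $\pi$ is contained in a block of $\pi'$. $\hat 0$ is the partition into singletons, $|\pi|$ is the number of blocks of $\pi$, and $\mu_{\Pi_G}$ is the Möbius function of $\Pi_G$. The characteristic polynomial of a finite ranked poset $P$ of length $\ell$ with minimum element $\hat 0$ is $\chi_P(t)=\sum_{x\in P}\mu_P(\hat 0,x)\,t^{\ell-\operatorname{rk}(x)}$,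 where $\operatorname{rk}(x)$ is the rank of $x$. An $\mathcal R$-D-permutation on $A$ is a permutation $\sigma$ of the set $A$ such that $i\le\sigma(i)$ whenever $i\in A$ is odd and $i\notin\mathcal R$, and $i\ge\sigma(i)$ whenever $i\in A$ is even (no condition at $i\in\mathcal R$). $\mathcal D_A^{\mathcal R}$ is the set of $\mathcal R$-D-permutations on $A$. The cycle support $\operatorname{cyc}(\sigma)$ is the set partition of $A$ whose blocks are the element sets of the cycles of $\sigma$ (fixed points give singleton blocks).
   Formalization: Both formulas get the missing factor (-1)^{|A|} (A={1} refutes the printed sign) and t^{k-1} becomes t^{k-c}, c = number of components of the graph (A={2,4} refutes t^{k-1}); as printed, the first holds for |A| even, the second for |A| even and the graph connected. *)

theory Defs
  imports
    "HOL-Library.Disjoint_Sets"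
    "HOL-Combinatorics.Permutations"
    "HOL-Combinatorics.Orbits"
    "HOL-Computational_Algebra.Polynomial"
begin

text \<open>A graph is a vertex set together with a set of edges, each edge being the set of its
  two endpoints.\<close>

definition adj :: "'a set set \<Rightarrow> 'a rel" where
  "adj E = {(u, v). {u, v} \<in> E}"

definition induced_edges :: "'a set set \<Rightarrow> 'a set \<Rightarrow> 'a set set" where
  "induced_edges E B = {e \<in> E. e \<subseteq> B}"

definition connected_graph :: "'a set \<Rightarrow> 'a set set \<Rightarrow> bool" where
  "connected_graph V E \<longleftrightarrow> V \<noteq> {} \<and> (\<forall>u\<in>V. \<forall>v\<in>V. (u, v) \<in> (adj E)\<^sup>*)"

definition graph_components :: "'a set \<Rightarrow> 'a set set \<Rightarrow> 'a set set" where
  "graph_components V E = V // {(u, v) \<in> V \<times> V. (u, v) \<in> (adj E)\<^sup>*}"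

definition RD_edges :: "nat set \<Rightarrow> nat \<Rightarrow> nat set set" where
  "RD_edges A m =
     {{u, v} | u v. u \<in> A \<and> v \<in> A \<and> u < v \<and> odd u \<and> even v} \<union>
     {{u, v} | u v. u \<in> A \<and> v \<in> A \<and> u < v \<and> v \<le> m \<and> odd u \<and> odd v}"

text \<open>A poset is given by its order relation \<open>r\<close>; the underlying set is \<open>Field r\<close>.\<close>

text \<open>The first condition is only there to make the recursion terminate: it says that \<open>r\<close>
  is a partial order, that \<open>x \<le> y\<close>, and that the interval from \<open>x\<close> to \<open>y\<close> is finite.\<close>

function moebius :: "'a rel \<Rightarrow> 'a \<Rightarrow> 'a \<Rightarrow> int" where
  "moebius r x y =
     (if Partial_order r \<and> (x, y) \<in> r \<and> finite {z. (x, z) \<in> r \<and> (z, y) \<in> r} then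
        (if x = y then 1
         else - (\<Sum>z \<in> {z. (x, z) \<in> r \<and> (z, y) \<in> r \<and> z \<noteq> y}. moebius r x z))
      else 0)"
  by pat_completeness auto
termination
proof (relation "measure (\<lambda>(r, x, y). card {z. (x, z) \<in> r \<and> (z, y) \<in> r})", goal_cases)
  case 1
  show ?case by simp
next
  case (2 r x y z)
  then have po: "trans r" "antisym r" "refl_on (Field r) r"
    by (auto simp: partial_order_on_def preorder_on_def)
  from 2 have z: "(x, z) \<in> r" "(z, y) \<in> r" "z \<noteq> y" and xy: "(x, y) \<in> r"
    and fin: "finite {w. (x, w) \<in> r \<and> (w, y) \<in> r}" by auto
  have "(y, y) \<in> r" using po(3) xy by (auto simp: refl_on_def Field_def)
  moreover have "(y, z) \<notin> r" using po(2) z by (auto dest: antisymD)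
  ultimately have "{w. (x, w) \<in> r \<and> (w, z) \<in> r} \<subset> {w. (x, w) \<in> r \<and> (w, y) \<in> r}"
    using z xy po(1) by (auto dest: transD)
  with fin show ?case by (simp add: psubset_card_mono)
qed

declare moebius.simps [simp del]

definition poset_bot :: "'a rel \<Rightarrow> 'a" where
  "poset_bot r = (THE z. z \<in> Field r \<and> (\<forall>y \<in> Field r. (z, y) \<in> r))"

definition poset_length :: "'a rel \<Rightarrow> nat" where
  "poset_length r = Max ((\<lambda>C. card C - 1) ` {C \<in> Chains r. C \<noteq> {}})"

text \<open>In a ranked poset the rank of \<open>x\<close> is the common length of the maximal chains of the
  order ideal below \<open>x\<close>, i.e. the length of that ideal.\<close>

definition poset_rank :: "'a rel \<Rightarrow> 'a \<Rightarrow> nat" where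
  "poset_rank r x = poset_length (Restr r (under r x))"

definition char_poly_poset :: "'a rel \<Rightarrow> int poly" where
  "char_poly_poset r =
     (\<Sum>x \<in> Field r. monom (moebius r (poset_bot r) x) (poset_length r - poset_rank r x))"

definition bonds :: "'a set \<Rightarrow> 'a set set \<Rightarrow> 'a set set set" where
  "bonds V E = {\<pi>. partition_on V \<pi> \<and> (\<forall>B \<in> \<pi>. connected_graph B (induced_edges E B))}"

definition bond_lattice :: "'a set \<Rightarrow> 'a set set \<Rightarrow> 'a set set rel" where
  "bond_lattice V E = {(\<pi>, \<rho>). \<pi> \<in> bonds V E \<and> \<rho> \<in> bonds V E \<and> refines V \<pi> \<rho>}"

definition singletons :: "'a set \<Rightarrow> 'a set set" where
  "singletons V = (\<lambda>a. {a}) ` V"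

definition RD_perms :: "nat set \<Rightarrow> nat set \<Rightarrow> (nat \<Rightarrow> nat) set" where
  "RD_perms A R =
     {\<sigma>. \<sigma> permutes A \<and>
          (\<forall>i \<in> A. odd i \<and> i \<notin> R \<longrightarrow> i \<le> \<sigma> i) \<and>
          (\<forall>i \<in> A. even i \<longrightarrow> \<sigma> i \<le> i)}"

definition cyc :: "'a set \<Rightarrow> ('a \<Rightarrow> 'a) \<Rightarrow> 'a set set" where
  "cyc A \<sigma> = orbit \<sigma> ` A"

definition s_RD :: "nat set \<Rightarrow> nat set \<Rightarrow> nat \<Rightarrow> int" where
  "s_RD A R k = (-1) ^ k * int (card {\<sigma> \<in> RD_perms A R. card (cyc A \<sigma>) = k})"

end

theory Submission
  imports Defs
begin

text \<open>
  The Moebius function of the bond lattice is characterised by \<open>\<mu>(0, 0) = 1\<close> and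
  \<open>\<Sum>\<^bsub>\<rho> \<le> \<pi>\<^esub> \<mu>(0, \<rho>) = 0\<close> for \<open>\<pi> \<noteq> 0\<close>. Since a permutation of \<open>A\<close> with cycle
  support \<open>\<rho>\<close> has sign \<open>(-1)\<close> to the power \<open>card A + card \<rho>\<close>, and since the cycle supports of the
  permutations in question are bonds, it is enough that the signs of those whose cycles refine a given
  bond \<open>\<pi> \<noteq> 0\<close> add up to zero. A block with at least two elements is connected iff its minimum is
  odd and its maximum is even or at most \<open>m\<close>; then precomposing with the transposition of its
  minimum and its maximum is a sign-reversing involution. The same description of connected blocks
  shows that a vertex can always be split off, which gives the ranks.
\<close>

subsection \<open>Cycle supports and signs\<close>

text \<open>The new map fixes \<open>a\<close> and sends a preimage of \<open>a\<close> under
  \<open>p\<close> straight to \<open>p a\<close>. So \<open>a\<close> is cut out of its cycle, and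
  nothing else changes.\<close>

lemma orbit_transpose_comp:
  assumes p: "inj p" and pa: "p a \<noteq> a" and z: "z \<noteq> a"
  shows "orbit (transpose a (p a) \<circ> p) z = orbit p z - {a}"
proof -
  define q where "q = transpose a (p a) \<circ> p"
  have q_ne: "q y \<noteq> a" if "y \<noteq> a" for y
    using that p pa by (auto simp: q_def transpose_def dest: injD)
  have q_orb: "q y \<in> orbit p y" if "y \<noteq> a" for y
    using that injD[OF p, of y a] by (auto simp: q_def transpose_def intro: orbit.intros)
  have q_eq: "q y = (if p y = a then p a else p y)" if "y \<noteq> a" for y
    using that p by (auto simp: q_def transpose_def dest: injD)
  have "y \<in> orbit p z - {a}" if "y \<in> orbit q z" for y
    using that
  proof induction
    case base
    then show ?case using q_ne[OF z] q_orb[OF z] by blast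
  next
    case (step y)
    then show ?case using q_ne[of y] q_orb[of y] orbit_trans[of "q y" p y z] by blast
  qed
  \<comment> \<open>While the walk of \<open>p\<close> stands at \<open>a\<close>, the walk of
    \<open>q\<close> has already reached \<open>p a\<close>; stated this way, the claim passes
    through the induction.\<close>
  moreover have "if y = a then p a \<in> orbit q z else y \<in> orbit q z" if "y \<in> orbit p z" for y
    using that
  proof induction
    case base
    then show ?case using q_eq[OF z] orbit.base[of q z] by (metis (full_types))
  next
    case (step y)
    then show ?case using pa q_eq[of y] orbit.step[of y q z] by (metis (full_types))
  qed
  ultimately show ?thesis unfolding q_def[symmetric] by (metis DiffE insertI1 subsetI subset_antisym)
qed

lemma orbit_eq_if_mem:
  assumes "permutation p" "y \<in> orbit p x"
  shows "orbit p y = orbit p x"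
  using assms orbit_trans orbit_swap permutation_self_in_orbit[OF assms(1)] by (metis subsetI subset_antisym)

lemma partition_on_cyc:
  assumes "finite A" "p permutes A"
  shows "partition_on A (cyc A p)"
proof -
  have p: "permutation p" using assms by (auto simp: permutation_permutes)
  show ?thesis
  proof (rule partition_onI)
    show "\<Union>(cyc A p) = A"
      using permutes_orbit_subset[OF assms(2)] permutation_self_in_orbit[OF p]
      by (fastforce simp: cyc_def)
    show "disjnt X Y" if "X \<in> cyc A p" "Y \<in> cyc A p" "X \<noteq> Y" for X Y
    proof -
      have "X = Y" if z: "z \<in> X" "z \<in> Y" for z
        using z \<open>X \<in> cyc A p\<close> \<open>Y \<in> cyc A p\<close>
        by (metis cyc_def imageE orbit_eq_if_mem[OF p])
      then show ?thesis using \<open>X \<noteq> Y\<close> by (auto simp: disjnt_iff)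
    qed
    show "{} \<notin> cyc A p" using orbit_nonempty by (force simp: cyc_def)
  qed
qed

text \<open>Induction on \<open>A\<close>, removing a point \<open>x\<close>. A fixed
  \<open>x\<close> takes one element and one cycle with it, which leaves the parity alone. Otherwise
  a transposition cuts \<open>x\<close> out of its cycle: the sign flips, one element goes, and the
  number of cycles stays.\<close>

lemma sign_conv_card_cyc:
  assumes "finite A" "p permutes A"
  shows "sign p = (-1) ^ (card A + card (cyc A p))"
  using assms
proof (induction A arbitrary: p rule: finite_induct)
  case empty
  then show ?case by (simp add: cyc_def)
next
  case (insert x S)
  have fin: "finite (insert x S)" using insert by simp
  have p: "permutation p" using fin insert.prems by (auto simp: permutation_permutes)
  show ?case
  proof (cases "p x = x")
    case True
    then have pS: "p permutes S" using insert.prems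
      by (metis Diff_insert_absorb insert.hyps(2) permutes_superset insertE insert_iff DiffE singletonD DiffD1 Diff_iff)
    have "orbit p x = {x}" using True by (simp add: orbit_eq_singleton_iff)
    moreover have "{x} \<notin> cyc S p"
      using partition_onD1[OF partition_on_cyc[OF insert.hyps(1) pS]] insert.hyps(2) by auto
    ultimately have "card (cyc (insert x S) p) = Suc (card (cyc S p))"
      using insert.hyps(1) by (simp add: cyc_def)
    then show ?thesis using insert.IH[OF pS] insert.hyps by simp
  next
    case False
    define q where "q = transpose x (p x) \<circ> p"
    have qS: "q permutes S" unfolding q_def by (rule permutes_insert_lemma[OF insert.prems])
    have pS: "p x \<in> S" using permutes_in_image[OF insert.prems, of x] False by auto
    \<comment> \<open>\<open>x\<close> lies in the cycle of \<open>p x\<close>, and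
      \<open>p x\<close> belongs to \<open>S\<close>, so starting at \<open>x\<close> gives no
      further cycle.\<close>
    have *: "cyc (insert x S) p = cyc S p"
      using permutation_orbit_step[OF p, of x] pS by (auto simp: cyc_def)
    have **: "cyc S q = (\<lambda>X. X - {x}) ` cyc S p"
      unfolding cyc_def image_image
      by (rule image_cong[OF refl], unfold q_def, rule orbit_transpose_comp)
        (use permutes_inj[OF insert.prems] False insert.hyps in auto)
    \<comment> \<open>Each of these cycles contains a point of \<open>S\<close>, which survives the
      deletion of \<open>x\<close> and determines the cycle.\<close>
    have "inj_on (\<lambda>X. X - {x}) (cyc S p)"
    proof (rule inj_onI)
      fix X Y assume XY: "X \<in> cyc S p" "Y \<in> cyc S p" "X - {x} = Y - {x}"
      then obtain y where y: "y \<in> S" "X = orbit p y" by (auto simp: cyc_def)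
      have "y \<in> X - {x}"
        using y insert.hyps permutation_self_in_orbit[OF p] by auto
      then have "y \<in> Y" using XY by auto
      then show "X = Y" using XY(2) y orbit_eq_if_mem[OF p] by (auto simp: cyc_def)
    qed
    then have "card (cyc (insert x S) p) = card (cyc S q)"
      by (simp add: * ** card_image)
    moreover have "sign p = - sign q"
      using False sign_compose[OF permutation_swap_id p, of x "p x"] by (simp add: q_def sign_swap_id)
    ultimately show ?thesis using insert.IH[OF qS] insert.hyps by simp
  qed
qed

subsection \<open>Moebius functions and bond lattices\<close>

text \<open>The vanishing sums express \<open>f y\<close> through values at smaller elements, by the
  recursion that also defines \<open>moebius\<close>; induction on the size of the interval
  identifies the two. A closed formula can thus be verified instead of derived.\<close>

lemma moebius_eqI:
  assumes r: "Partial_order r" and fin: "\<And>y. finite {z. (x, z) \<in> r \<and> (z, y) \<in> r}"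
    and one: "f x = 1"
    and zero: "\<And>y. (x, y) \<in> r \<Longrightarrow> y \<noteq> x \<Longrightarrow> (\<Sum>z | (x, z) \<in> r \<and> (z, y) \<in> r. f z) = 0"
    and xy: "(x, y) \<in> r"
  shows "moebius r x y = f y"
  using xy
proof (induction "card {z. (x, z) \<in> r \<and> (z, y) \<in> r}" arbitrary: y rule: less_induct)
  case less
  have po: "trans r" "antisym r" "refl_on (Field r) r"
    using r by (auto simp: partial_order_on_def preorder_on_def)
  have yy: "(y, y) \<in> r" using po(3) less.prems by (auto simp: refl_on_def Field_def)
  let ?I = "{z. (x, z) \<in> r \<and> (z, y) \<in> r}"
  have IH: "moebius r x z = f z" if z: "(x, z) \<in> r" "(z, y) \<in> r" "z \<noteq> y" for z
  proof (rule less.hyps)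
    have "(y, z) \<notin> r" using po(2) z by (auto dest: antisymD)
    then have "{w. (x, w) \<in> r \<and> (w, z) \<in> r} \<subset> ?I"
      using z less.prems yy po(1) by (auto dest: transD)
    then show "card {w. (x, w) \<in> r \<and> (w, z) \<in> r} < card ?I"
      by (simp add: psubset_card_mono fin)
  qed fact
  show ?case
  proof (cases "x = y")
    case True
    then show ?thesis using one less.prems r fin by (simp add: moebius.simps)
  next
    case False
    have I: "?I = insert y {z. (x, z) \<in> r \<and> (z, y) \<in> r \<and> z \<noteq> y}" (is "_ = insert y ?J")
      using less.prems yy by auto
    have "finite ?J" by (rule finite_subset[OF _ fin[of y]]) auto
    then have "f y + (\<Sum>z\<in>?J. f z) = 0"
      using zero[OF less.prems] False I by simp
    moreover have "moebius r x y = - (\<Sum>z\<in>?J. moebius r x z)"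
      using False less.prems r fin by (simp add: moebius.simps[of r x y])
    moreover have "(\<Sum>z\<in>?J. moebius r x z) = (\<Sum>z\<in>?J. f z)"
      by (rule sum.cong) (auto simp: IH)
    ultimately show ?thesis by simp
  qed
qed

text \<open>Sending each block of \<open>P\<close> to the block of \<open>Q\<close> that contains it
  is a surjection. If the cardinalities agree it is also injective, so each block of
  \<open>Q\<close> contains a single block of \<open>P\<close> and equals it.\<close>

lemma refines_card:
  assumes "finite A" "refines A P Q"
  shows "card Q \<le> card P" and "card Q = card P \<Longrightarrow> P = Q"
proof -
  have P: "partition_on A P" and Q: "partition_on A Q" and sub: "\<forall>X\<in>P. \<exists>Y\<in>Q. X \<subseteq> Y"
    using assms(2) by (auto simp: refines_def)
  have finP: "finite P" and finQ: "finite Q" using finite_elements[OF assms(1)] P Q by auto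
  obtain g where g: "\<And>X. X \<in> P \<Longrightarrow> g X \<in> Q \<and> X \<subseteq> g X" using sub by metis
  have uniq: "Y = Z" if "Y \<in> Q" "Z \<in> Q" "y \<in> Y" "y \<in> Z" for Y Z y
    using that partition_onD2[OF Q] by (auto simp: disjoint_def)
  have cover: "\<exists>X\<in>P. y \<in> X \<and> g X = Y" if "Y \<in> Q" "y \<in> Y" for Y y
  proof -
    have "y \<in> \<Union>P" using that partition_onD1[OF P] partition_onD1[OF Q] by auto
    then show ?thesis using g uniq that by blast
  qed
  have "Q \<subseteq> g ` P"
  proof
    fix Y assume Y: "Y \<in> Q"
    then obtain y where "y \<in> Y" using partition_onD3[OF Q] by (metis ex_in_conv)
    then show "Y \<in> g ` P" using cover[OF Y] by blast
  qed
  then have gP: "g ` P = Q" using g by auto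
  show "card Q \<le> card P" using gP card_image_le[OF finP, of g] by simp
  assume eq: "card Q = card P"
  then have inj: "inj_on g P" using gP finP by (simp add: eq_card_imp_inj_on)
  have "P \<subseteq> Q"
  proof
    fix X assume X: "X \<in> P"
    have "g X \<subseteq> X" using cover[of "g X"] g[OF X] X inj by (metis inj_onD subsetI)
    then show "X \<in> Q" using g[OF X] by auto
  qed
  then show "P = Q" using eq finQ by (simp add: card_subset_eq)
qed

text \<open>An orbit that starts in an invariant block never leaves it. The criterion is pointwise,
  hence easy to check for a permutation that has been modified at two points.\<close>

lemma refines_cyc_iff:
  assumes "finite A" "p permutes A" "partition_on A \<pi>"
  shows "refines A (cyc A p) \<pi> \<longleftrightarrow> (\<forall>Y\<in>\<pi>. \<forall>i\<in>Y. p i \<in> Y)"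
proof
  have p: "permutation p" using assms by (auto simp: permutation_permutes)
  have UA: "\<Union>\<pi> = A" using partition_onD1[OF assms(3)] by simp
  {
    assume ref: "refines A (cyc A p) \<pi>"
    show "\<forall>Y\<in>\<pi>. \<forall>i\<in>Y. p i \<in> Y"
    proof (intro ballI)
      fix Y i assume Y: "Y \<in> \<pi>" "i \<in> Y"
      then have "orbit p i \<in> cyc A p" using UA by (auto simp: cyc_def)
      then obtain Z where Z: "Z \<in> \<pi>" "orbit p i \<subseteq> Z" using ref by (auto simp: refines_def)
      then have "i \<in> Z" using permutation_self_in_orbit[OF p] by auto
      then have "Z = Y" using Y Z partition_onD2[OF assms(3)] by (auto simp: disjoint_def)
      then show "p i \<in> Y" using Z(2) orbit.base[of p i] by auto
    qed
  next
    assume inv: "\<forall>Y\<in>\<pi>. \<forall>i\<in>Y. p i \<in> Y"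
    have "\<exists>Y\<in>\<pi>. orbit p x \<subseteq> Y" if "x \<in> A" for x
    proof -
      obtain Y where Y: "Y \<in> \<pi>" "x \<in> Y" using \<open>x \<in> A\<close> UA by blast
      have "y \<in> Y" if "y \<in> orbit p x" for y using that by induction (use Y inv in auto)
      then show ?thesis using Y by auto
    qed
    then show "refines A (cyc A p) \<pi>"
      using partition_on_cyc[OF assms(1,2)] assms(3) by (auto simp: refines_def cyc_def)
  }
qed

section \<open>The bond lattice of an arbitrary graph\<close>

lemma sym_adj: "sym (adj E)"
  by (auto simp: sym_def adj_def insert_commute)

lemma connected_graph_singleton: "connected_graph {a} E"
  by (auto simp: connected_graph_def)

lemma finite_bonds: "finite A \<Longrightarrow> finite (bonds A E)"
  by (rule finite_subset[OF _ finitely_many_partition_on[of A]]) (auto simp: bonds_def)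

lemma bond_lattice_iff:
  "(\<pi>, \<rho>) \<in> bond_lattice A E \<longleftrightarrow> \<pi> \<in> bonds A E \<and> \<rho> \<in> bonds A E \<and> refines A \<pi> \<rho>"
  by (simp add: bond_lattice_def)

lemma Field_bond_lattice: "Field (bond_lattice A E) = bonds A E"
  by (auto simp: Field_def bond_lattice_def bonds_def intro: refines_refl)

lemma Partial_order_bond_lattice: "Partial_order (bond_lattice A E)"
  unfolding partial_order_on_def preorder_on_def Field_bond_lattice
  by (auto simp: refl_on_def trans_def antisym_def bond_lattice_iff bonds_def
      intro: refines_refl refines_trans dest: refines_asym)

lemma singletons_in_bonds: "singletons A \<in> bonds A E"
  by (auto simp: bonds_def singletons_def partition_on_singletons connected_graph_singleton)

lemma singletons_refines: "partition_on A \<pi> \<Longrightarrow> refines A (singletons A) \<pi>"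
  unfolding refines_def singletons_def
  using partition_on_singletons[of A] partition_onD1[of A \<pi>] by blast

lemma card_singletons: "card (singletons A) = card A"
  by (simp add: singletons_def card_image inj_on_def)

lemma poset_bot_bond_lattice: "poset_bot (bond_lattice A E) = singletons A"
  unfolding poset_bot_def Field_bond_lattice
proof (rule the_equality)
  show *: "singletons A \<in> bonds A E \<and> (\<forall>y\<in>bonds A E. (singletons A, y) \<in> bond_lattice A E)"
    using singletons_in_bonds singletons_refines by (auto simp: bond_lattice_iff bonds_def)
  show "z = singletons A" if "z \<in> bonds A E \<and> (\<forall>y\<in>bonds A E. (z, y) \<in> bond_lattice A E)" for z
    using that * refines_asym[of A z "singletons A"] by (simp add: bond_lattice_iff)
qed

lemma ex_nonsingleton_block:
  assumes "partition_on A \<pi>" "\<pi> \<noteq> singletons A"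
  obtains B where "B \<in> \<pi>" "\<And>a. B \<noteq> {a}"
proof -
  have "\<exists>B\<in>\<pi>. \<forall>a. B \<noteq> {a}"
  proof (rule ccontr)
    assume *: "\<not> ?thesis"
    have "\<pi> = singletons A"
    proof (intro equalityI subsetI)
      fix X assume "X \<in> \<pi>"
      then show "X \<in> singletons A" using * partition_onD1[OF assms(1)] by (fastforce simp: singletons_def)
    next
      fix X assume "X \<in> singletons A"
      then obtain a where a: "X = {a}" "a \<in> A" by (auto simp: singletons_def)
      then obtain Y where "Y \<in> \<pi>" "a \<in> Y" using partition_onD1[OF assms(1)] by auto
      then show "X \<in> \<pi>" using * a by fastforce
    qed
    then show False using assms by simp
  qed
  then show ?thesis using that by blast
qed

section \<open>The partition into components as the greatest bond\<close>

lemma graph_component_eq: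
  assumes "C \<in> graph_components V E" "a \<in> C"
  shows "C = {v \<in> V. (a, v) \<in> (adj E)\<^sup>*}"
proof -
  have sym: "(u, v) \<in> (adj E)\<^sup>*" if "(v, u) \<in> (adj E)\<^sup>*" for u v
    using sym_rtrancl[OF sym_adj] that by (rule symD)
  from assms obtain c where c: "c \<in> V" "C = {v \<in> V. (c, v) \<in> (adj E)\<^sup>*}"
    by (auto simp: graph_components_def quotient_def)
  then have "(c, a) \<in> (adj E)\<^sup>*" "(a, c) \<in> (adj E)\<^sup>*" using assms(2) sym by auto
  then show ?thesis using c by (auto intro: rtrancl_trans)
qed

lemma partition_on_graph_components: "partition_on V (graph_components V E)"
  unfolding graph_components_def
proof (rule partition_on_quotient)
  show "equiv V {(u, v) \<in> V \<times> V. (u, v) \<in> (adj E)\<^sup>*}"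
    by (auto simp: equiv_def refl_on_def trans_def sym_def intro: rtrancl_trans
        symD[OF sym_rtrancl[OF sym_adj]])
qed

text \<open>A walk that starts in a component stays there, so all its edges are induced edges of
  that component.\<close>

lemma graph_components_in_bonds:
  assumes "\<Union>E \<subseteq> V"
  shows "graph_components V E \<in> bonds V E"
proof -
  have "connected_graph C (induced_edges E C)" if C: "C \<in> graph_components V E" for C
  proof -
    have "(a, v) \<in> (adj (induced_edges E C))\<^sup>*" if a: "a \<in> C" and v: "v \<in> C" for a v
    proof -
      note Ca = graph_component_eq[OF C a]
      have "a \<in> V" using a Ca by auto
      have "(a, v) \<in> (adj E)\<^sup>*" using v Ca by auto
      then show ?thesis
      proof induction
        case base
        show ?case by simp
      next
        case (step y z)
        have "{y, z} \<in> E" using step by (simp add: adj_def)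
        then have "y \<in> V" "z \<in> V" using assms by auto
        then have "y \<in> C" "z \<in> C" using Ca step.hyps by (auto intro: rtrancl_into_rtrancl)
        then have "(y, z) \<in> adj (induced_edges E C)"
          using \<open>{y, z} \<in> E\<close> by (auto simp: adj_def induced_edges_def)
        with step.IH show ?case by (rule rtrancl_into_rtrancl)
      qed
    qed
    moreover have "C \<noteq> {}" using C partition_onD3[OF partition_on_graph_components] by auto
    ultimately show ?thesis by (auto simp: connected_graph_def)
  qed
  then show ?thesis using partition_on_graph_components by (auto simp: bonds_def)
qed

text \<open>A walk inside a block is a walk in the whole graph, so a block cannot meet two
  components. The components therefore form the greatest bond, from which the length of the lattice
  is read off.\<close>

lemma bond_refines_graph_components:
  assumes "\<pi> \<in> bonds V E"
  shows "refines V \<pi> (graph_components V E)"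
proof -
  have \<pi>: "partition_on V \<pi>" using assms by (simp add: bonds_def)
  have "\<exists>C\<in>graph_components V E. B \<subseteq> C" if B: "B \<in> \<pi>" for B
  proof -
    have con: "connected_graph B (induced_edges E B)" using assms B by (simp add: bonds_def)
    then obtain b where b: "b \<in> B" by (auto simp: connected_graph_def)
    have BV: "B \<subseteq> V" using B partition_onD1[OF \<pi>] by auto
    then obtain C where C: "C \<in> graph_components V E" "b \<in> C"
      using b partition_onD1[OF partition_on_graph_components[of V E]] by auto
    have "adj (induced_edges E B) \<subseteq> adj E" by (auto simp: adj_def induced_edges_def)
    from rtrancl_mono[OF this] have "(b, v) \<in> (adj E)\<^sup>*" if "v \<in> B" for v
      using con b that unfolding connected_graph_def by blast
    then have "B \<subseteq> C" using graph_component_eq[OF C] BV by auto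
    then show ?thesis using C by auto
  qed
  then show ?thesis using \<pi> partition_on_graph_components by (auto simp: refines_def)
qed

lemma graph_components_connected:
  assumes "connected_graph V E"
  shows "graph_components V E = {V}"
proof -
  have "C = V" if C: "C \<in> graph_components V E" for C
  proof -
    have "C \<noteq> {}" using C partition_onD3[OF partition_on_graph_components] by auto
    then obtain a where "a \<in> C" by auto
    then show ?thesis using graph_component_eq[OF C] assms by (auto simp: connected_graph_def)
  qed
  moreover have "graph_components V E \<noteq> {}"
    using assms partition_onD1[OF partition_on_graph_components[of V E]] by (auto simp: connected_graph_def)
  ultimately show ?thesis by blast
qed

subsection \<open>Permutations and connected blocks\<close>

text \<open>The two kinds of edges differ only in the larger endpoint, so a single condition covers
  both. It does not mention \<open>A\<close> apart from \<open>e \<subseteq> A\<close>, which makes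
  restriction to a block immediate.\<close>

lemma RD_edges_eq:
  "RD_edges A m =
    {e. e \<subseteq> A \<and> (\<exists>u v. e = {u, v} \<and> u < v \<and> odd u \<and> (even v \<or> v \<le> m))}"
  unfolding RD_edges_def by blast

lemma induced_RD_edges: "B \<subseteq> A \<Longrightarrow> induced_edges (RD_edges A m) B = RD_edges B m"
  unfolding induced_edges_def RD_edges_eq by blast

lemma Union_RD_edges: "\<Union>(RD_edges A m) \<subseteq> A"
  by (auto simp: RD_edges_def)

lemma RD_edges_iff:
  "u < v \<Longrightarrow> {u, v} \<in> RD_edges B m \<longleftrightarrow> u \<in> B \<and> v \<in> B \<and> odd u \<and> (even v \<or> v \<le> m)"
  by (auto simp: RD_edges_def doubleton_eq_iff)

text \<open>In a connected block with several points the minimum is the smaller endpoint of some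
  edge and the maximum the larger endpoint of some edge; this gives necessity. Conversely, an odd
  minimum is joined to every other vertex that is even or at most \<open>m\<close>, and the
  remaining vertices are reached through the maximum.\<close>

lemma connected_RD_iff:
  assumes "finite B" and "\<And>a. B \<noteq> {a}"
  shows "connected_graph B (RD_edges B m) \<longleftrightarrow>
    B \<noteq> {} \<and> odd (Min B) \<and> (even (Max B) \<or> Max B \<le> m)"
proof
  assume con: "connected_graph B (RD_edges B m)"
  then have ne: "B \<noteq> {}" by (simp add: connected_graph_def)
  have nbr: "\<exists>y\<in>B. y \<noteq> x \<and> {x, y} \<in> RD_edges B m" if x: "x \<in> B" for x
  proof -
    obtain z where z: "z \<in> B" "z \<noteq> x" using assms(2)[of x] x by auto
    then have "(x, z) \<in> (adj (RD_edges B m))\<^sup>*" using con x by (simp add: connected_graph_def)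
    then obtain y where "(x, y) \<in> adj (RD_edges B m)" using z(2) by (metis converse_rtranclE)
    then have y: "{x, y} \<in> RD_edges B m" by (simp add: adj_def)
    then have "y \<noteq> x" by (auto simp: RD_edges_def doubleton_eq_iff)
    then show ?thesis using y Union_RD_edges[of B m] by blast
  qed
  obtain y where y: "y \<in> B" "y \<noteq> Min B" "{Min B, y} \<in> RD_edges B m"
    using nbr[of "Min B"] ne assms(1) by auto
  then have "Min B < y" using assms(1) by (simp add: order_neq_le_trans)
  then have 1: "odd (Min B)" using y RD_edges_iff by blast
  obtain z where z: "z \<in> B" "z \<noteq> Max B" "{z, Max B} \<in> RD_edges B m"
    using nbr[of "Max B"] ne assms(1) by (auto simp: insert_commute)
  then have "z < Max B" using assms(1) by (simp add: order_neq_le_trans)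
  then have 2: "even (Max B) \<or> Max B \<le> m" using z RD_edges_iff by blast
  show "B \<noteq> {} \<and> odd (Min B) \<and> (even (Max B) \<or> Max B \<le> m)" using 1 2 ne by blast
next
  assume *: "B \<noteq> {} \<and> odd (Min B) \<and> (even (Max B) \<or> Max B \<le> m)"
  let ?r = "adj (RD_edges B m)"
  have in_B: "Min B \<in> B" "Max B \<in> B" using * assms(1) by auto
  have edge: "(u, v) \<in> ?r" if "u \<in> B" "v \<in> B" "u < v" "odd u" "even v \<or> v \<le> m" for u v
    using that RD_edges_iff[of u v B m] by (simp add: adj_def)
  have from_Min: "(Min B, v) \<in> ?r\<^sup>*" if v: "v \<in> B" for v
  proof (cases "v = Min B")
    case True
    then show ?thesis by simp
  next
    case False
    then have less: "Min B < v" using v assms(1) by (simp add: order_neq_le_trans)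
    show ?thesis
    proof (cases "even v \<or> v \<le> m")
      case True
      then show ?thesis using edge[OF in_B(1) v less] * by blast
    next
      case F: False
      have "v \<le> Max B" using v assms(1) by simp
      \<comment> \<open>\<open>Max B\<close> is at least \<open>v\<close> and hence exceeds
        \<open>m\<close>, so it must be even; \<open>v\<close> is odd and therefore differs from
        it.\<close>
      with F * have "even (Max B)" "v < Max B" by (auto simp: order.order_iff_strict)
      then have "(Min B, Max B) \<in> ?r" "(v, Max B) \<in> ?r" using edge in_B v F * less by auto
      then show ?thesis using symD[OF sym_adj] by (meson r_into_rtrancl rtrancl_into_rtrancl)
    qed
  qed
  then have "(u, v) \<in> ?r\<^sup>*" if "u \<in> B" "v \<in> B" for u v
    using that symD[OF sym_rtrancl[OF sym_adj]] by (meson rtrancl_trans)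
  then show "connected_graph B (RD_edges B m)" using * by (simp add: connected_graph_def)
qed

text \<open>On a nontrivial cycle no point is fixed, so the minimum moves up and the maximum moves
  down. The first is forbidden to even points, the second to odd points above \<open>m\<close>, and
  \<open>connected_RD_iff\<close> applies.\<close>

lemma cyc_in_bonds:
  assumes "finite A" "\<sigma> \<in> RD_perms A ({i. odd i \<and> i \<le> m} \<inter> A)"
  shows "cyc A \<sigma> \<in> bonds A (RD_edges A m)"
proof -
  have per: "\<sigma> permutes A" and up: "\<And>i. i \<in> A \<Longrightarrow> odd i \<Longrightarrow> \<not> i \<le> m \<Longrightarrow> i \<le> \<sigma> i"
    and down: "\<And>i. i \<in> A \<Longrightarrow> even i \<Longrightarrow> \<sigma> i \<le> i"
    using assms(2) by (auto simp: RD_perms_def)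
  have p: "permutation \<sigma>" using per assms(1) by (auto simp: permutation_permutes)
  have part: "partition_on A (cyc A \<sigma>)" by (rule partition_on_cyc[OF assms(1) per])
  have "connected_graph B (induced_edges (RD_edges A m) B)" if B: "B \<in> cyc A \<sigma>" for B
  proof (cases "\<exists>a. B = {a}")
    case True
    then show ?thesis by (auto intro: connected_graph_singleton)
  next
    case False
    have BA: "B \<subseteq> A" using B partition_onD1[OF part] by auto
    then have fin: "finite B" using assms(1) finite_subset by auto
    have ne: "B \<noteq> {}" using B partition_onD3[OF part] by auto
    have moved: "\<sigma> x \<in> B \<and> \<sigma> x \<noteq> x" if "x \<in> B" for x
    proof -
      have "B = orbit \<sigma> x" using B that orbit_eq_if_mem[OF p] by (auto simp: cyc_def)
      then show ?thesis using False orbit.base[of \<sigma> x] orbit_eq_singleton_iff[of \<sigma> x] by auto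
    qed
    have Min: "Min B \<in> B" and Max: "Max B \<in> B" using ne fin by auto
    have "Min B < \<sigma> (Min B)" using moved[OF Min] fin by (simp add: order_neq_le_trans)
    then have "odd (Min B)" using down[of "Min B"] Min BA by fastforce
    moreover have "\<sigma> (Max B) < Max B" using moved[OF Max] fin by (simp add: order_neq_le_trans)
    then have "even (Max B) \<or> Max B \<le> m" using up[of "Max B"] Max BA by fastforce
    ultimately show ?thesis
      using connected_RD_iff[OF fin, of m] False ne BA by (simp add: induced_RD_edges)
  qed
  then show ?thesis using part by (simp add: bonds_def)
qed

text \<open>The least and the greatest element of a nontrivial block are subject to no condition within
  that block, so that exchanging their images reverses the sign.\<close>

lemma sum_sign_RD_perms_refining:
  assumes "finite A" "\<pi> \<in> bonds A (RD_edges A m)" "\<pi> \<noteq> singletons A"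
  shows "(\<Sum>\<sigma> | \<sigma> \<in> RD_perms A ({i. odd i \<and> i \<le> m} \<inter> A) \<and> refines A (cyc A \<sigma>) \<pi>. sign \<sigma>) = 0"
    (is "sum sign ?S = 0")
proof -
  have part: "partition_on A \<pi>" using assms(2) by (simp add: bonds_def)
  obtain B where B: "B \<in> \<pi>" "\<And>a. B \<noteq> {a}" using ex_nonsingleton_block[OF part assms(3)] by blast
  have BA: "B \<subseteq> A" using B partition_onD1[OF part] by auto
  then have fin: "finite B" using assms(1) finite_subset by auto
  define a b where "a = Min B" and "b = Max B"
  have con: "connected_graph B (RD_edges B m)"
    using assms(2) B(1) BA induced_RD_edges[of B A m] by (auto simp: bonds_def)
  have ne: "B \<noteq> {}" and oddMin: "odd a" and b: "even b \<or> b \<le> m"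
    using con connected_RD_iff[OF fin B(2)] by (auto simp: a_def b_def)
  have aB: "a \<in> B" and bB: "b \<in> B" using ne fin by (auto simp: a_def b_def)
  have le: "a \<le> x" "x \<le> b" if "x \<in> B" for x using that fin by (auto simp: a_def b_def)
  have ab: "a \<noteq> b"
  proof
    assume "a = b"
    then have "B = {a}" using le aB by (auto intro: antisym)
    then show False using B(2) by auto
  qed
  \<comment> \<open>With all conditions pointwise, only \<open>a\<close> and \<open>b\<close> need
    attention after the exchange.\<close>
  have S_iff: "\<sigma> \<in> ?S \<longleftrightarrow> \<sigma> permutes A \<and> (\<forall>i\<in>A. odd i \<and> \<not> i \<le> m \<longrightarrow> i \<le> \<sigma> i) \<and>
      (\<forall>i\<in>A. even i \<longrightarrow> \<sigma> i \<le> i) \<and> (\<forall>Y\<in>\<pi>. \<forall>i\<in>Y. \<sigma> i \<in> Y)" for \<sigma>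
    using refines_cyc_iff[OF assms(1) _ part, of \<sigma>] by (auto simp: RD_perms_def)
  define h where "h \<sigma> = \<sigma> \<circ> transpose a b" for \<sigma> :: "nat \<Rightarrow> nat"
  have hS: "h \<sigma> \<in> ?S" if S: "\<sigma> \<in> ?S" for \<sigma>
  proof -
    note * = S[unfolded S_iff]
    have hB: "h \<sigma> a = \<sigma> b" "h \<sigma> b = \<sigma> a" "h \<sigma> a \<in> B" "h \<sigma> b \<in> B"
      using * B(1) aB bB by (auto simp: h_def)
    have other: "h \<sigma> i = \<sigma> i" if "i \<noteq> a" "i \<noteq> b" for i
      using that by (simp add: h_def transpose_apply_other)
    have "h \<sigma> permutes A"
      unfolding h_def using * permutes_swap_id[of a A b] aB bB BA by (auto intro: permutes_compose)
    \<comment> \<open>The point \<open>b\<close> is exempt, being even or at most \<open>m\<close>;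
      at \<open>a\<close> the inequality holds because the new image lies in \<open>B\<close>, whose
      minimum is \<open>a\<close>. The even case is the mirror image, with \<open>a\<close> exempt
      because it is odd.\<close>
    moreover have "i \<le> h \<sigma> i" if "i \<in> A" "odd i" "\<not> i \<le> m" for i
    proof -
      have "i \<noteq> b" using that b by auto
      then show ?thesis using that * other[of i] le(1)[OF hB(3)] by (cases "i = a") auto
    qed
    moreover have "h \<sigma> i \<le> i" if "i \<in> A" "even i" for i
    proof -
      have "i \<noteq> a" using that oddMin by auto
      then show ?thesis using that * other[of i] le(2)[OF hB(4)] by (cases "i = b") auto
    qed
    moreover have "h \<sigma> i \<in> Y" if "Y \<in> \<pi>" "i \<in> Y" for Y i
    proof (cases "i = a \<or> i = b")
      case True
      then have "Y = B" using that B(1) aB bB partition_onD2[OF part] by (auto simp: disjoint_def)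
      then show ?thesis using True hB by auto
    next
      case False
      then show ?thesis using that * other[of i] by auto
    qed
    ultimately show ?thesis unfolding S_iff by blast
  qed
  have hh: "h (h \<sigma>) = \<sigma>" for \<sigma> by (simp add: h_def comp_assoc)
  have "sum sign ?S = (\<Sum>\<sigma>\<in>?S. sign (h \<sigma>))"
    by (rule sum.reindex_bij_witness[of _ h h]) (use hS hh in auto)
  also have "\<dots> = (\<Sum>\<sigma>\<in>?S. - sign \<sigma>)"
  proof (rule sum.cong[OF refl])
    fix \<sigma> assume "\<sigma> \<in> ?S"
    then have "permutation \<sigma>" using assms(1) S_iff by (auto simp: permutation_permutes)
    then show "sign (h \<sigma>) = - sign \<sigma>"
      using ab by (simp add: h_def sign_compose permutation_swap_id sign_swap_id)
  qed
  also have "\<dots> = - sum sign ?S" by (rule sum_negf)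
  finally show ?thesis by simp
qed

section \<open>The Moebius function as a signed count of permutations\<close>

lemma finite_RD_perms: "finite A \<Longrightarrow> finite (RD_perms A R)"
  by (rule finite_subset[OF _ finite_permutations[of A]]) (auto simp: RD_perms_def)

text \<open>The right-hand side is the sum of the signs of the permutations with cycle support
  \<open>\<pi>\<close>, so \<open>moebius_eqI\<close> reduces the claim to the cancellation of signs
  below each nontrivial bond.\<close>

lemma moebius_bond_lattice_RD:
  assumes "finite A" "\<pi> \<in> bonds A (RD_edges A m)"
  shows "moebius (bond_lattice A (RD_edges A m)) (singletons A) \<pi> =
    (-1) ^ (card A + card \<pi>) *
      int (card {\<sigma> \<in> RD_perms A ({i. odd i \<and> i \<le> m} \<inter> A). cyc A \<sigma> = \<pi>})"
proof -
  let ?E = "RD_edges A m" and ?D = "RD_perms A ({i. odd i \<and> i \<le> m} \<inter> A)"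
  let ?L = "bond_lattice A ?E" and ?bot = "singletons A"
  define f where "f \<pi> = (-1) ^ (card A + card \<pi>) * int (card {\<sigma> \<in> ?D. cyc A \<sigma> = \<pi>})" for \<pi>
  have finD: "finite ?D" by (rule finite_RD_perms[OF assms(1)])
  have f_sum: "f \<pi> = (\<Sum>\<sigma> | \<sigma> \<in> ?D \<and> cyc A \<sigma> = \<pi>. sign \<sigma>)" for \<pi>
  proof -
    have "(\<Sum>\<sigma> | \<sigma> \<in> ?D \<and> cyc A \<sigma> = \<pi>. sign \<sigma>) =
        (\<Sum>\<sigma> | \<sigma> \<in> ?D \<and> cyc A \<sigma> = \<pi>. (-1) ^ (card A + card \<pi>))"
      by (rule sum.cong[OF refl]) (auto simp: RD_perms_def sign_conv_card_cyc[OF assms(1)])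
    then show ?thesis by (simp add: f_def)
  qed
  have down: "(?bot, z) \<in> ?L \<and> (z, y) \<in> ?L \<longleftrightarrow> z \<in> bonds A ?E \<and> refines A z y"
    if "y \<in> bonds A ?E" for y z
    using that singletons_in_bonds[of A ?E] singletons_refines[of A z]
    by (auto simp: bond_lattice_iff bonds_def)
  have "moebius ?L ?bot \<pi> = f \<pi>"
  proof (rule moebius_eqI[OF Partial_order_bond_lattice])
    show "finite {z. (?bot, z) \<in> ?L \<and> (z, y) \<in> ?L}" for y
      by (rule finite_subset[OF _ finite_bonds[OF assms(1), of ?E]]) (auto simp: bond_lattice_iff)
    \<comment> \<open>Only the identity has trivial cycles throughout; since the exponent at the
      bottom is \<open>card A + card A\<close>, the value there is 1.\<close>
    have "{\<sigma> \<in> ?D. cyc A \<sigma> = ?bot} = {id}"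
    proof (intro equalityI subsetI)
      fix \<sigma> assume \<sigma>: "\<sigma> \<in> {\<sigma> \<in> ?D. cyc A \<sigma> = ?bot}"
      then have per: "\<sigma> permutes A" by (simp add: RD_perms_def)
      have "\<sigma> x = x" if "x \<in> A" for x
      proof -
        have "refines A (cyc A \<sigma>) ?bot"
          using \<sigma> partition_on_cyc[OF assms(1) per] by (auto intro: refines_refl)
        moreover have "{x} \<in> ?bot" using that by (simp add: singletons_def)
        ultimately show ?thesis
          using refines_cyc_iff[OF assms(1) per, of ?bot] partition_on_singletons[of A]
          by (fastforce simp: singletons_def)
      qed
      then show "\<sigma> \<in> {id}" using per by (auto simp: permutes_def fun_eq_iff)
    next
      have "orbit id x = {x}" for x :: nat by (simp add: orbit_eq_singleton_iff)
      then show "\<sigma> \<in> {\<sigma> \<in> ?D. cyc A \<sigma> = ?bot}" if "\<sigma> \<in> {id}" for \<sigma>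
        using that by (auto simp: RD_perms_def cyc_def singletons_def permutes_id)
    qed
    then show "f ?bot = 1" by (simp add: f_def card_singletons)
    show "(?bot, \<pi>) \<in> ?L"
      using assms(2) singletons_in_bonds[of A ?E] singletons_refines[of A \<pi>]
      by (auto simp: bond_lattice_iff bonds_def)
    fix y assume y: "(?bot, y) \<in> ?L" "y \<noteq> ?bot"
    then have yb: "y \<in> bonds A ?E" by (simp add: bond_lattice_iff)
    let ?T = "{z \<in> bonds A ?E. refines A z y}" and ?S = "{\<sigma> \<in> ?D. refines A (cyc A \<sigma>) y}"
    have "(\<Sum>z | (?bot, z) \<in> ?L \<and> (z, y) \<in> ?L. f z) = (\<Sum>z\<in>?T. f z)"
      by (simp only: down[OF yb])
    \<comment> \<open>The permutations are grouped by cycle support. No permutation is lost, because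
      every cycle support is a bond.\<close>
    also have "\<dots> = (\<Sum>z\<in>?T. \<Sum>\<sigma> | \<sigma> \<in> ?S \<and> cyc A \<sigma> = z. sign \<sigma>)"
      unfolding f_sum by (rule sum.cong[OF refl], rule sum.cong) auto
    also have "\<dots> = (\<Sum>\<sigma>\<in>?S. sign \<sigma>)"
    proof (rule sum.group)
      show "finite ?S" using finD by simp
      show "finite ?T" using finite_bonds[OF assms(1), of ?E] by simp
      show "cyc A ` ?S \<subseteq> ?T" using cyc_in_bonds[OF assms(1), of _ m] by blast
    qed
    also have "\<dots> = 0" using sum_sign_RD_perms_refining[OF assms(1) yb y(2)] by simp
    finally show "(\<Sum>z | (?bot, z) \<in> ?L \<and> (z, y) \<in> ?L. f z) = 0" .
  qed
  then show ?thesis by (simp add: f_def)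
qed

subsection \<open>Ranks and the characteristic polynomial\<close>

text \<open>The new partition arises by dropping \<open>B\<close> and inserting first
  \<open>B - C\<close> and then \<open>C\<close>, each nonempty and disjoint from what is already
  there.\<close>

lemma partition_on_split_block:
  assumes "partition_on A \<pi>" "B \<in> \<pi>" "C \<subset> B" "C \<noteq> {}"
  shows "partition_on A (insert C (insert (B - C) (\<pi> - {B})))"
    and "refines A (insert C (insert (B - C) (\<pi> - {B}))) \<pi>"
    and "finite \<pi> \<Longrightarrow> card (insert C (insert (B - C) (\<pi> - {B}))) = Suc (card \<pi>)"
proof -
  let ?\<pi> = "\<pi> - {B}"
  have \<pi>: "\<Union>\<pi> = A" "disjoint \<pi>" "{} \<notin> \<pi>" using assms(1) by (auto simp: partition_on_def)
  have disj: "X \<inter> B = {}" if "X \<in> ?\<pi>" for X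
    using that \<pi>(2) assms(2) by (auto simp: disjoint_def)
  have disj_Union: "X \<inter> \<Union>?\<pi> = {}" if "X \<subseteq> B" for X using disj that by blast
  have BA: "B \<subseteq> A" using assms(2) \<pi>(1) by blast
  have "insert B ?\<pi> = \<pi>" using assms(2) by blast
  then have "partition_on (A - B) ?\<pi>"
    using assms(1) partition_on_insert[of B ?\<pi> A] disj_Union[of B] by (simp add: disjnt_def)
  moreover have "A - C - (B - C) = A - B" using assms(3) by blast
  moreover have "disjnt (B - C) (\<Union>?\<pi>)" using disj_Union[of "B - C"] by (simp add: disjnt_def)
  moreover have "B - C \<subseteq> A - C" "B - C \<noteq> {}" using BA assms(3) by blast+
  ultimately have "partition_on (A - C) (insert (B - C) ?\<pi>)" by (simp add: partition_on_insert)
  moreover have "disjnt C (\<Union>(insert (B - C) ?\<pi>))"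
    using disj_Union[of C] assms(3) by (auto simp: disjnt_def)
  moreover have "C \<subseteq> A" using assms(3) BA by blast
  ultimately show part: "partition_on A (insert C (insert (B - C) ?\<pi>))"
    using assms(4) by (simp add: partition_on_insert)
  show "refines A (insert C (insert (B - C) ?\<pi>)) \<pi>"
    using part assms by (auto simp: refines_def)
  show "card (insert C (insert (B - C) ?\<pi>)) = Suc (card \<pi>)" if "finite \<pi>"
  proof -
    have "C \<notin> ?\<pi>" "B - C \<notin> ?\<pi>" "C \<noteq> B - C" using disj assms by blast+
    then show ?thesis using that card.remove[OF that assms(2)] by simp
  qed
qed

text \<open>Connectedness depends only on the minimum and the maximum, so any other vertex can go.
  If there is none, removing the maximum leaves a single vertex.\<close>

lemma connected_RD_remove_vertex:
  assumes "finite B" "connected_graph B (RD_edges B m)" "\<And>a. B \<noteq> {a}"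
  obtains x where "x \<in> B" "B - {x} \<noteq> {}" "connected_graph (B - {x}) (RD_edges (B - {x}) m)"
proof -
  have B: "B \<noteq> {}" "odd (Min B)" "even (Max B) \<or> Max B \<le> m"
    using connected_RD_iff[OF assms(1,3)] assms(2) by auto
  have mem: "Min B \<in> B" "Max B \<in> B" using assms(1) B(1) by auto
  show ?thesis
  proof (cases "B \<subseteq> {Min B, Max B}")
    case True
    then have eq: "B = {Min B, Max B}" using mem by auto
    then have "Min B \<noteq> Max B" using assms(3) by (metis insert_absorb2)
    with eq have "B - {Max B} = {Min B}"
      by (metis Diff_insert_absorb insert_absorb insert_commute insert_ident singletonD)
    then show ?thesis using that[of "Max B"] mem connected_graph_singleton[of "Min B"] by simp
  next
    case False
    then obtain x where x: "x \<in> B" "x \<noteq> Min B" "x \<noteq> Max B" by auto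
    have fin: "finite (B - {x})" using assms(1) by simp
    have "Min (B - {x}) = Min B" "Max (B - {x}) = Max B"
      using mem x assms(1) by (auto intro!: Min_eqI Max_eqI)
    moreover have ne: "B - {x} \<noteq> {}" using mem x by auto
    ultimately have "connected_graph (B - {x}) (RD_edges (B - {x}) m)"
      using connected_RD_iff[OF fin, of m] B connected_graph_singleton by metis
    then show ?thesis using that x(1) ne by blast
  qed
qed

text \<open>Splitting a removable vertex off a nontrivial block leaves two connected pieces; this is
  one step down in rank.\<close>

lemma ex_bond_covered:
  assumes "finite A" "\<pi> \<in> bonds A (RD_edges A m)" "\<pi> \<noteq> singletons A"
  obtains \<rho> where "\<rho> \<in> bonds A (RD_edges A m)" "refines A \<rho> \<pi>" "card \<rho> = Suc (card \<pi>)"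
proof -
  have part: "partition_on A \<pi>" using assms(2) by (simp add: bonds_def)
  obtain B where B: "B \<in> \<pi>" "\<And>a. B \<noteq> {a}" using ex_nonsingleton_block[OF part assms(3)] by blast
  have BA: "B \<subseteq> A" using B partition_onD1[OF part] by auto
  have fin: "finite B" using BA assms(1) finite_subset by auto
  have con: "connected_graph B (RD_edges B m)"
    using assms(2) B(1) BA induced_RD_edges[of B A m] by (auto simp: bonds_def)
  obtain x where x: "x \<in> B" "B - {x} \<noteq> {}" "connected_graph (B - {x}) (RD_edges (B - {x}) m)"
    using connected_RD_remove_vertex[OF fin con B(2)] by blast
  have "{x} \<subset> B" using x by auto
  note split = partition_on_split_block[OF part B(1) this]
  have "B - {x} \<subseteq> A" using BA by auto
  then have "connected_graph (B - {x}) (induced_edges (RD_edges A m) (B - {x}))"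
    using x(3) by (simp add: induced_RD_edges)
  then have "insert {x} (insert (B - {x}) (\<pi> - {B})) \<in> bonds A (RD_edges A m)"
    using split(1) assms(2) connected_graph_singleton by (auto simp: bonds_def)
  then show ?thesis using that split finite_elements[OF assms(1) part] by auto
qed

text \<open>Splitting off one vertex at a time descends from \<open>\<pi>\<close> to a bond with
  \<open>card A\<close> blocks, and each step adds one block. The chain attains the upper bound for
  the rank.\<close>

lemma ex_chain_below_bond:
  assumes "finite A" "\<pi> \<in> bonds A (RD_edges A m)"
  shows "\<exists>C \<in> Chains (bond_lattice A (RD_edges A m)).
    \<pi> \<in> C \<and> (\<forall>\<rho>\<in>C. refines A \<rho> \<pi>) \<and> card C - 1 = card A - card \<pi>"
  using assms(2)
proof (induction "card A - card \<pi>" arbitrary: \<pi>)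
  case 0
  then have "partition_on A \<pi>" by (simp add: bonds_def)
  then have "{\<pi>} \<in> Chains (bond_lattice A (RD_edges A m))" "refines A \<pi> \<pi>"
    using "0.prems" by (auto simp: Chains_def bond_lattice_iff intro: refines_refl)
  then show ?case using "0.hyps" by (intro bexI[of _ "{\<pi>}"]) auto
next
  case (Suc n)
  let ?L = "bond_lattice A (RD_edges A m)"
  have "\<pi> \<noteq> singletons A" using Suc.hyps(2) card_singletons[of A] by auto
  then obtain \<rho> where \<rho>: "\<rho> \<in> bonds A (RD_edges A m)" "refines A \<rho> \<pi>" "card \<rho> = Suc (card \<pi>)"
    using ex_bond_covered[OF assms(1) Suc.prems] by blast
  then have "n = card A - card \<rho>" using Suc.hyps(2) by simp
  then obtain C where C: "C \<in> Chains ?L" "\<rho> \<in> C" "\<And>\<tau>. \<tau> \<in> C \<Longrightarrow> refines A \<tau> \<rho>"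
      "card C - 1 = card A - card \<rho>"
    using Suc.hyps(1)[OF _ \<rho>(1)] by blast
  have part: "partition_on A \<pi>" using Suc.prems by (simp add: bonds_def)
  have C_bonds: "C \<subseteq> bonds A (RD_edges A m)"
    using C(1) by (auto simp: Chains_def bond_lattice_iff)
  then have fin: "finite C" using finite_bonds[OF assms(1)] finite_subset by blast
  have le: "refines A \<tau> \<pi>" if "\<tau> \<in> C" for \<tau> using C(3)[OF that] \<rho>(2) by (rule refines_trans)
  have "\<pi> \<notin> C"
  proof
    assume "\<pi> \<in> C"
    then have "refines A \<pi> \<rho>" by (rule C(3))
    then show False using refines_card(1)[OF assms(1)] \<rho>(3) by fastforce
  qed
  \<comment> \<open>Positivity makes the truncated \<open>card C - 1\<close> exact, so that
    inserting \<open>\<pi>\<close> raises the length by one.\<close>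
  have "0 < card C" using C(2) fin by (auto simp: card_gt_0_iff)
  then have "card (insert \<pi> C) - 1 = card A - card \<pi>"
    using \<open>\<pi> \<notin> C\<close> fin C(4) \<open>n = _\<close> Suc.hyps(2) by simp
  moreover have "insert \<pi> C \<in> Chains ?L"
    using C(1) C_bonds Suc.prems le refines_refl[OF part]
    by (auto simp: Chains_def bond_lattice_iff)
  ultimately show ?case using le refines_refl[OF part] by (intro bexI[of _ "insert \<pi> C"]) auto
qed

text \<open>Comparable partitions with equally many blocks coincide, so along a chain below
  \<open>\<pi>\<close> the numbers of blocks are distinct values between \<open>card \<pi>\<close>
  and \<open>card A\<close>. This bounds the length, and \<open>ex_chain_below_bond\<close> attains
  the bound.\<close>

lemma poset_rank_bond:
  assumes "finite A" "\<pi> \<in> bonds A (RD_edges A m)"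
  shows "poset_rank (bond_lattice A (RD_edges A m)) \<pi> = card A - card \<pi>"
proof -
  let ?L = "bond_lattice A (RD_edges A m)"
  let ?I = "Restr ?L (under ?L \<pi>)"
  have fin: "finite C" if "C \<in> Chains ?I" for C
    by (rule finite_subset[OF _ finite_bonds[OF assms(1), of "RD_edges A m"]])
      (use that in \<open>auto simp: Chains_def bond_lattice_iff\<close>)
  have upper: "card C - 1 \<le> card A - card \<pi>" if C: "C \<in> Chains ?I" for C
  proof -
    have C': "\<rho> \<in> bonds A (RD_edges A m)" "refines A \<rho> \<pi>" if "\<rho> \<in> C" for \<rho>
      using C that by (auto simp: Chains_def under_def bond_lattice_iff)
    have "inj_on card C"
    proof (rule inj_onI)
      fix \<rho> \<tau> assume *: "\<rho> \<in> C" "\<tau> \<in> C" "card \<rho> = card \<tau>"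
      then have "refines A \<rho> \<tau> \<or> refines A \<tau> \<rho>"
        using C by (fastforce simp: Chains_def bond_lattice_iff)
      then show "\<rho> = \<tau>" using refines_card(2)[OF assms(1)] *(3) by metis
    qed
    moreover have "card ` C \<subseteq> {card \<pi>..card A}"
    proof (intro image_subsetI)
      fix \<rho> assume "\<rho> \<in> C"
      note \<rho> = C'[OF this]
      have "refines A (singletons A) \<rho>" using \<rho>(1) by (auto simp: bonds_def intro: singletons_refines)
      then show "card \<rho> \<in> {card \<pi>..card A}"
        using refines_card(1)[OF assms(1)] \<rho>(2) card_singletons[of A] by fastforce
    qed
    ultimately have "card C \<le> card {card \<pi>..card A}" using card_inj_on_le by blast
    then show ?thesis by simp
  qed
  obtain C where C: "C \<in> Chains ?L" "\<pi> \<in> C" "\<And>\<rho>. \<rho> \<in> C \<Longrightarrow> refines A \<rho> \<pi>"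
      "card C - 1 = card A - card \<pi>"
    using ex_chain_below_bond[OF assms] by blast
  then have "C \<in> Chains ?I"
    using assms(2) by (auto simp: Chains_def under_def bond_lattice_iff)
  then have C_in: "card A - card \<pi> \<in> (\<lambda>C. card C - 1) ` {C \<in> Chains ?I. C \<noteq> {}}"
    using C(2,4) by (intro image_eqI[of _ _ C]) auto
  show ?thesis
    unfolding poset_rank_def poset_length_def
  proof (rule Max_eqI[OF _ _ C_in])
    show "finite ((\<lambda>C. card C - 1) ` {C \<in> Chains ?I. C \<noteq> {}})"
      by (rule finite_subset[of _ "{..card A - card \<pi>}"]) (use upper in auto)
  qed (use upper in auto)
qed

text \<open>The ideal below the greatest bond is the whole lattice, so the length is the rank of
  that bond.\<close>

lemma poset_length_bond_lattice:
  assumes "finite A"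
  shows "poset_length (bond_lattice A (RD_edges A m)) = card A - card (graph_components A (RD_edges A m))"
proof -
  let ?E = "RD_edges A m"
  let ?L = "bond_lattice A ?E" and ?top = "graph_components A ?E"
  have top: "?top \<in> bonds A ?E" by (rule graph_components_in_bonds[OF Union_RD_edges])
  then have "\<pi> \<in> under ?L ?top" if "\<pi> \<in> bonds A ?E" for \<pi>
    using that bond_refines_graph_components[OF that] by (simp add: under_def bond_lattice_iff)
  then have "Restr ?L (under ?L ?top) = ?L" by (auto simp: bond_lattice_iff)
  then show ?thesis using poset_rank_bond[OF assms top] by (simp add: poset_rank_def)
qed

text \<open>Length minus rank is \<open>card \<pi>\<close> minus the number of components. The
  monomial factor raises this exponent to \<open>card \<pi>\<close>, after which bonds are collected
  by their number of blocks.\<close>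

lemma char_poly_bond_lattice_RD:
  fixes A :: "nat set" and m :: nat
  assumes "finite A"
  defines "R \<equiv> {i. odd i \<and> i \<le> m} \<inter> A"
  defines "E \<equiv> RD_edges A m"
  shows "monom 1 (card (graph_components A E)) * char_poly_poset (bond_lattice A E) =
    (-1) ^ card A * (\<Sum>k = 0..card A. monom (s_RD A R k) k)"
proof -
  let ?L = "bond_lattice A E" and ?c = "card (graph_components A E)"
  let ?N = "\<lambda>\<pi>. card {\<sigma> \<in> RD_perms A R. cyc A \<sigma> = \<pi>}"
  have finB: "finite (bonds A E)" by (rule finite_bonds[OF assms(1)])
  have le_card: "?c \<le> card \<pi>" "card \<pi> \<le> card A" if "\<pi> \<in> bonds A E" for \<pi>
  proof -
    show "?c \<le> card \<pi>"
      using bond_refines_graph_components[OF that] by (rule refines_card(1)[OF assms(1)])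
    have "refines A (singletons A) \<pi>" using that by (auto simp: bonds_def intro: singletons_refines)
    then show "card \<pi> \<le> card A" using refines_card(1)[OF assms(1)] card_singletons by metis
  qed
  have count: "(\<Sum>\<pi> | \<pi> \<in> bonds A E \<and> card \<pi> = k. int (?N \<pi>)) =
      int (card {\<sigma> \<in> RD_perms A R. card (cyc A \<sigma>) = k})" for k
  proof -
    let ?S = "{\<sigma> \<in> RD_perms A R. card (cyc A \<sigma>) = k}" and ?T = "{\<pi> \<in> bonds A E. card \<pi> = k}"
    have "(\<Sum>\<pi>\<in>?T. ?N \<pi>) = (\<Sum>\<pi>\<in>?T. \<Sum>\<sigma> | \<sigma> \<in> ?S \<and> cyc A \<sigma> = \<pi>. 1)"
      by (rule sum.cong[OF refl]) (auto intro!: arg_cong[of _ _ card])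
    also have "\<dots> = (\<Sum>\<sigma>\<in>?S. 1)"
    proof (rule sum.group)
      show "finite ?S" using finite_RD_perms[OF assms(1), of R] by simp
      show "finite ?T" using finB by simp
      show "cyc A ` ?S \<subseteq> ?T"
        using cyc_in_bonds[OF assms(1), of _ m] by (auto simp: R_def E_def)
    qed
    finally show ?thesis by (simp flip: of_nat_sum)
  qed
  have "monom 1 ?c * char_poly_poset ?L =
      (\<Sum>\<pi>\<in>bonds A E. monom (moebius ?L (singletons A) \<pi>) (card \<pi>))"
    unfolding char_poly_poset_def Field_bond_lattice sum_distrib_left poset_bot_bond_lattice
  proof (rule sum.cong[OF refl])
    fix \<pi> assume \<pi>: "\<pi> \<in> bonds A E"
    \<comment> \<open>All truncated differences are exact because
      \<open>?c \<le> card \<pi> \<le> card A\<close>.\<close>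
    have "?c + (poset_length ?L - poset_rank ?L \<pi>) = card \<pi>"
      using le_card[OF \<pi>] poset_rank_bond[OF assms(1), of \<pi> m] \<pi> poset_length_bond_lattice[OF assms(1), of m]
      by (simp add: E_def)
    then show "monom 1 ?c * monom (moebius ?L (singletons A) \<pi>) (poset_length ?L - poset_rank ?L \<pi>) =
        monom (moebius ?L (singletons A) \<pi>) (card \<pi>)"
      by (simp add: mult_monom)
  qed
  also have "\<dots> = (\<Sum>k = 0..card A. \<Sum>\<pi> | \<pi> \<in> bonds A E \<and> card \<pi> = k.
      monom (moebius ?L (singletons A) \<pi>) (card \<pi>))"
    by (rule sum.group[symmetric]) (use finB le_card in auto)
  also have "\<dots> = (\<Sum>k = 0..card A. monom ((-1) ^ card A * s_RD A R k) k)"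
  proof (rule sum.cong[OF refl])
    fix k
    have "(\<Sum>\<pi> | \<pi> \<in> bonds A E \<and> card \<pi> = k. monom (moebius ?L (singletons A) \<pi>) (card \<pi>)) =
        (\<Sum>\<pi> | \<pi> \<in> bonds A E \<and> card \<pi> = k. monom ((-1) ^ card A * (-1) ^ k * int (?N \<pi>)) k)"
      using moebius_bond_lattice_RD[OF assms(1), of _ m]
      by (intro sum.cong[OF refl]) (auto simp: E_def R_def power_add)
    also have "\<dots> = monom (\<Sum>\<pi> | \<pi> \<in> bonds A E \<and> card \<pi> = k. (-1) ^ card A * (-1) ^ k * int (?N \<pi>)) k"
      by (simp add: monom_sum)
    also have "\<dots> = monom ((-1) ^ card A * s_RD A R k) k"
      by (simp add: sum_distrib_left[symmetric] count s_RD_def mult.assoc)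
    finally show "(\<Sum>\<pi> | \<pi> \<in> bonds A E \<and> card \<pi> = k. monom (moebius ?L (singletons A) \<pi>) (card \<pi>)) =
        monom ((-1) ^ card A * s_RD A R k) k" .
  qed
  \<comment> \<open>The sign is an integer inside the monomials and a polynomial in front of the
    sum; the parity of \<open>card A\<close> decides both.\<close>
  also have "\<dots> = (-1) ^ card A * (\<Sum>k = 0..card A. monom (s_RD A R k) k)"
    by (cases "even (card A)") (simp_all add: sum_negf flip: minus_monom)
  finally show ?thesis .
qed

text \<open>The Moebius value is a count times \<open>(-1)\<close> to the power
  \<open>card A + card \<pi>\<close>, so the general identities carry the factor
  \<open>(-1) ^ card A\<close>: for a one-element \<open>A\<close> the left side of the first one is
  -1. The monomial factor accounts for the number of components. The last two conjuncts are the
  forms without these corrections, for even \<open>card A\<close> and, in the polynomial identity, a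
  connected graph.\<close>

theorem theorem1p2:
  fixes A R :: "nat set" and m :: nat
  assumes "finite A" and "0 \<notin> A" and "odd m"
    and "R = {i. odd i \<and> i \<le> m} \<inter> A"
  defines "E \<equiv> RD_edges A m"
  defines "L \<equiv> bond_lattice A E"
  shows
    "(\<forall>\<pi> \<in> bonds A E.
        (-1) ^ card \<pi> * moebius L (singletons A) \<pi>
          = (-1) ^ card A * int (card {\<sigma> \<in> RD_perms A R. cyc A \<sigma> = \<pi>}))
     \<and> monom 1 (card (graph_components A E)) * char_poly_poset L
          = (-1) ^ card A * (\<Sum>k = 0..card A. monom (s_RD A R k) k)
     \<and> (\<forall>k. (-1) ^ k * s_RD A R k = int (card {\<sigma> \<in> RD_perms A R. card (cyc A \<sigma>) = k}))
     \<and> (even (card A) \<longrightarrow>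
          (\<forall>\<pi> \<in> bonds A E.
             (-1) ^ card \<pi> * moebius L (singletons A) \<pi>
               = int (card {\<sigma> \<in> RD_perms A R. cyc A \<sigma> = \<pi>})))
     \<and> (even (card A) \<and> connected_graph A E \<longrightarrow>
          char_poly_poset L = (\<Sum>k = 1..card A. monom (s_RD A R k) (k - 1)))"
proof -
  have moebius: "(-1) ^ card \<pi> * moebius L (singletons A) \<pi> =
      (-1) ^ card A * int (card {\<sigma> \<in> RD_perms A R. cyc A \<sigma> = \<pi>})" if "\<pi> \<in> bonds A E" for \<pi>
  proof -
    have "(-1) ^ card \<pi> * ((-1) ^ (card A + card \<pi>) * x) = (-1) ^ card A * x" for x :: int
      by (cases "even (card \<pi>)") (simp_all add: power_add)
    then show ?thesis
      using moebius_bond_lattice_RD[OF assms(1), of \<pi> m] that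
      by (simp only: assms(4) E_def L_def)
  qed
  have char_poly: "monom 1 (card (graph_components A E)) * char_poly_poset L =
      (-1) ^ card A * (\<Sum>k = 0..card A. monom (s_RD A R k) k)"
    using char_poly_bond_lattice_RD[OF assms(1), of m] by (simp add: assms(4) E_def L_def)
  have s_RD: "(-1) ^ k * s_RD A R k = int (card {\<sigma> \<in> RD_perms A R. card (cyc A \<sigma>) = k})" for k
    by (simp add: s_RD_def flip: mult.assoc power_mult_distrib)
  have connected: "char_poly_poset L = (\<Sum>k = 1..card A. monom (s_RD A R k) (k - 1))"
    if "even (card A)" "connected_graph A E"
  proof -
    have "A \<noteq> {}" using that(2) by (simp add: connected_graph_def)
    \<comment> \<open>On a nonempty set every permutation has a cycle, so the term for
      \<open>k = 0\<close> vanishes and one factor \<open>monom 1 1\<close> can be cancelled from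
      both sides.\<close>
    have "cyc A \<sigma> \<noteq> {} \<and> finite (cyc A \<sigma>)" for \<sigma> using \<open>A \<noteq> {}\<close> assms(1) by (simp add: cyc_def)
    then have "s_RD A R 0 = 0" by (simp add: s_RD_def)
    then have "(\<Sum>k = 0..card A. monom (s_RD A R k) k) = (\<Sum>k = 1..card A. monom (s_RD A R k) k)"
      by (simp add: sum.atLeast_Suc_atMost)
    also have "\<dots> = monom 1 1 * (\<Sum>k = 1..card A. monom (s_RD A R k) (k - 1))"
      by (simp add: sum_distrib_left mult_monom)
    finally have "monom 1 1 * char_poly_poset L =
        monom 1 1 * (\<Sum>k = 1..card A. monom (s_RD A R k) (k - 1))"
      using char_poly that graph_components_connected[OF that(2)] by simp
    moreover have "(monom 1 1 :: int poly) \<noteq> 0" by simp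
    ultimately show ?thesis by (simp only: mult_cancel_left) simp
  qed
  show ?thesis
    using moebius char_poly s_RD connected by simp
qed

end
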